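(* Let $(L,A,[\,\cdot\,,\ldots,\cdot\,],\rho)$ be an $n$-Lie--Rinehart algebra and let $B:L\times L\to A$ be a symmetric $A$-bilinear form. Let $X=x_1\wedge\cdots\wedge x_{n-1}$ be a fundamental element with $x_1,\ldots,x_{n-1}\in L$, and let $1\le i\le n-1$. Then for every $a\in A$ and all $u,v\in L$, $$(D_{X_{a,i}}B)(u,v)=a(D_XB)(u,v)-(-1)^{n-i}\rho(X_i(u))(a)\,B(x_i,v)-(-1)^{n-i}\rho(X_i(v))(a)\,B(x_i,u).$$
   Context: $K$ is a field of characteristic zero, $A$ is a commutative associative $K$-algebra, $n\ge 2$ is an integer, and $\operatorname{Der}_K(A)$ is the $A$-module of $K$-linear derivations of $A$, with commutator bracket. An $n$-Lie algebra over $K$ is a $K$-vector space $L$ with an alternating $K$-multilinear bracket $[\,\cdot\,,\ldots,\cdot\,]:L^n\to L$ satisfying the Filippov identity $[x_1,\ldots,x_{n-1},[y_1,\ldots,y_n]]=\sum_{i=1}^n[y_1,\ldots,[x_1,\ldots,x_{n-1},y_i],\ldots,y_n]$. For $X=x_1\wedge\cdots\wedge x_{n-1}$ and $Y=y_1\wedge\cdots\wedge y_{n-1}$ (fundamental elements, with chosen representatives) put $[X,z]=[x_1,\ldots,x_{n-1},z]$ and $X\circ Y=\sum_{i=1}^{n-1}y_1\wedge\cdots\wedge[X,y_i]\wedge\cdots\wedge y_{n-1}$. An $n$-Lie--Rinehart algebra over $A$ is a quadruple $(L,A,[\,\cdot\,,\ldots,\cdot\,],\rho)$ such that: (i) $L$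 is an $A$-module and an $n$-Lie algebra over $K$; (ii)--(iii) $\rho:\bigwedge_A^{n-1}L\to\operatorname{Der}_K(A)$ (the anchor), regarded as an alternating $A$-multilinear map $\rho(x_1,\ldots,x_{n-1})=\rho(x_1\wedge\cdots\wedge x_{n-1})$, satisfies $[\rho(X),\rho(Y)]=\rho(X\circ Y)$ for all fundamental elements $X,Y$; (iv) $[x_1,\ldots,x_{n-1},ay]=a[x_1,\ldots,x_{n-1},y]+\rho(x_1,\ldots,x_{n-1})(a)\,y$ for all $x_j,y\in L$, $a\in A$. For a symmetric $A$-bilinear form $B$ on $L$ and a fundamental element $X$, the orthogonality defect is $(D_XB)(u,v)=\rho(X)(B(u,v))-B([X,u],v)-B(u,[X,v])$ for $u,v\in L$. For $X=x_1\wedge\cdots\wedge x_{n-1}$, $1\le i\le n-1$, $a\in A$, $u\in L$: $X_{a,i}=x_1\wedge\cdots\wedge ax_i\wedge\cdots\wedge x_{n-1}$ (the $i$-th factor $x_i$ replaced by $ax_i$, with this representative used in $[X_{a,i},u]=[x_1,\ldots,ax_i,\ldots,x_{n-1},u]$) and $X_i(u)=x_1\wedge\cdots\wedge\widehat{x_i}\wedge\cdots\wedge x_{n-1}\wedge u$ ($x_i$ omitted, $u$ appended at the end). *)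

theory Defs
  imports "HOL-Algebra.Module"
begin

text \<open>
  Conventions.  An element \<open>(x\<^sub>1, \<dots>, x\<^sub>k)\<close> of \<open>L\<^sup>k\<close>, and likewise a chosen representative of a fundamental
  element \<open>x\<^sub>1 \<and> \<dots> \<and> x\<^sub>k\<close>, is a list of length \<open>k\<close> over \<open>carrier L\<close>; the entry \<open>x\<^sub>i\<close> of such a
  list \<open>xs\<close> is \<open>xs ! (i - 1)\<close>.  Algebras (commutative, associative) and modules are unital, as
  in the locales \<^locale>\<open>algebra\<close> and \<^locale>\<open>module\<close>; the zero ring is a legitimate algebra.
\<close>

definition char_zero :: "('k, 'c) ring_scheme \<Rightarrow> bool" where
  "char_zero K \<longleftrightarrow> (\<forall>m::nat. m > 0 \<longrightarrow> [m] \<cdot>\<^bsub>K\<^esub> \<one>\<^bsub>K\<^esub> \<noteq> \<zero>\<^bsub>K\<^esub>)"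


subsection \<open>Linear, bilinear and alternating multilinear maps\<close>

text \<open>Nothing is assumed about the values of \<open>f\<close> outside \<open>carrier M\<close>.\<close>

definition linear_map ::
  "('r, 'c) ring_scheme \<Rightarrow> ('r, 'm, 'd) module_scheme \<Rightarrow> ('r, 'n, 'e) module_scheme \<Rightarrow> ('m \<Rightarrow> 'n) \<Rightarrow> bool"
  where
  "linear_map R M N f \<longleftrightarrow>
     f \<in> carrier M \<rightarrow> carrier N \<and>
     (\<forall>x\<in>carrier M. \<forall>y\<in>carrier M. f (x \<oplus>\<^bsub>M\<^esub> y) = f x \<oplus>\<^bsub>N\<^esub> f y) \<and>
     (\<forall>r\<in>carrier R. \<forall>x\<in>carrier M. f (r \<odot>\<^bsub>M\<^esub> x) = r \<odot>\<^bsub>N\<^esub> f x)"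

definition tuples :: "nat \<Rightarrow> ('m, 'c) partial_object_scheme \<Rightarrow> 'm list set" where
  "tuples k M = {xs. length xs = k \<and> set xs \<subseteq> carrier M}"

definition alternating_map ::
  "('r, 'c) ring_scheme \<Rightarrow> ('r, 'm, 'd) module_scheme \<Rightarrow> ('r, 'n, 'e) module_scheme \<Rightarrow> nat \<Rightarrow>
   ('m list \<Rightarrow> 'n) \<Rightarrow> bool" where
  "alternating_map R M N k f \<longleftrightarrow>
     (\<forall>xs \<in> tuples k M. \<forall>i<k. linear_map R M N (\<lambda>z. f (xs[i := z]))) \<and>
     (\<forall>xs \<in> tuples k M. \<forall>i<k. \<forall>j<k. i \<noteq> j \<and> xs ! i = xs ! j \<longrightarrow> f xs = \<zero>\<^bsub>N\<^esub>)"

text \<open>\<open>A\<close> is itself an \<open>A\<close>-module by multiplication.\<close>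

definition regular_module :: "('a, 'd) ring_scheme \<Rightarrow> ('a, 'a) module" where
  "regular_module A =
     \<lparr>carrier = carrier A, mult = mult A, one = one A, zero = zero A, add = add A, smult = mult A\<rparr>"

definition symmetric_bilinear_form ::
  "('a, 'd) ring_scheme \<Rightarrow> ('a, 'l, 'e) module_scheme \<Rightarrow> ('l \<Rightarrow> 'l \<Rightarrow> 'a) \<Rightarrow> bool" where
  "symmetric_bilinear_form A L B \<longleftrightarrow>
     (\<forall>v\<in>carrier L. linear_map A L (regular_module A) (\<lambda>u. B u v)) \<and>
     (\<forall>u\<in>carrier L. linear_map A L (regular_module A) (\<lambda>v. B u v)) \<and>
     (\<forall>u\<in>carrier L. \<forall>v\<in>carrier L. B u v = B v u)"

text \<open>The \<open>K\<close>-space underlying an \<open>A\<close>-module, where \<open>k \<in> K\<close> acts as \<open>k \<cdot> 1\<^sub>A\<close>.\<close>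

definition restrict_scalars ::
  "('k, 'a, 'd) module_scheme \<Rightarrow> ('a, 'l, 'e) module_scheme \<Rightarrow> ('k, 'l) module" where
  "restrict_scalars A L =
     \<lparr>carrier = carrier L, mult = mult L, one = one L, zero = zero L, add = add L,
      smult = (\<lambda>k x. (k \<odot>\<^bsub>A\<^esub> \<one>\<^bsub>A\<^esub>) \<odot>\<^bsub>L\<^esub> x)\<rparr>"


lemma restrict_scalars_module:
  assumes "algebra K A" "module A L" shows "module K (restrict_scalars A L)"
proof -
  interpret A: algebra K A by fact
  interpret L: module A L by fact
  have ab: "abelian_group (restrict_scalars A L)"
    by (rule abelian_groupI) (auto simp: restrict_scalars_def L.a_ac intro: L.l_neg bexI[of _ "\<ominus>\<^bsub>L\<^esub> x" for x])
  show ?thesis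
    apply (rule moduleI)
    apply (rule A.R_cring)
    apply (rule ab)
    apply (auto simp: restrict_scalars_def A.smult_l_distr L.smult_l_distr L.smult_r_distr)
    apply (subst L.smult_assoc1[symmetric])
    apply (auto simp: A.smult_assoc1 A.smult_assoc2)
    done
qed


subsection \<open>Derivations\<close>

text \<open>
  \<open>Der K A\<close> is the \<open>A\<close>-module of \<open>K\<close>-linear derivations of \<open>A\<close>.  Its elements are made
  extensional (\<open>undefined\<close> off \<open>carrier A\<close>), so that equality in \<open>Der K A\<close> is equality of maps on
  \<open>carrier A\<close>.  The ring-multiplication fields of the record have no meaning for a module.
\<close>

definition Der :: "('k, 'c) ring_scheme \<Rightarrow> ('k, 'a, 'd) module_scheme \<Rightarrow> ('a, 'a \<Rightarrow> 'a) module" where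
  "Der K A =
     \<lparr>carrier = {D \<in> carrier A \<rightarrow>\<^sub>E carrier A. linear_map K A A D \<and>
        (\<forall>a\<in>carrier A. \<forall>b\<in>carrier A. D (a \<otimes>\<^bsub>A\<^esub> b) = D a \<otimes>\<^bsub>A\<^esub> b \<oplus>\<^bsub>A\<^esub> a \<otimes>\<^bsub>A\<^esub> D b)},
      mult = (\<lambda>_ _. undefined), one = undefined,
      zero = (\<lambda>a\<in>carrier A. \<zero>\<^bsub>A\<^esub>),
      add = (\<lambda>D E. \<lambda>a\<in>carrier A. D a \<oplus>\<^bsub>A\<^esub> E a),
      smult = (\<lambda>b D. \<lambda>a\<in>carrier A. b \<otimes>\<^bsub>A\<^esub> D a)\<rparr>"

definition commutator :: "('a, 'd) ring_scheme \<Rightarrow> ('a \<Rightarrow> 'a) \<Rightarrow> ('a \<Rightarrow> 'a) \<Rightarrow> 'a \<Rightarrow> 'a" where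
  "commutator A D E = (\<lambda>a\<in>carrier A. D (E a) \<ominus>\<^bsub>A\<^esub> E (D a))"


lemma Der_module:
  assumes "algebra K A" shows "module A (Der K A)"
proof -
  interpret A: algebra K A by fact
  let ?D = "Der K A"
  have ab: "abelian_group ?D"
  proof (rule abelian_groupI)
    fix D E assume "D \<in> carrier ?D" "E \<in> carrier ?D"
    then show "D \<oplus>\<^bsub>?D\<^esub> E \<in> carrier ?D"
      apply (auto simp: Der_def linear_map_def A.smult_r_distr PiE_iff Pi_iff)
      subgoal by (simp add: A.M.add.m_ac)
      subgoal by (simp add: A.l_distr A.r_distr A.M.add.m_ac)
      done
  next
    show "\<zero>\<^bsub>?D\<^esub> \<in> carrier ?D"
      by (auto simp: Der_def linear_map_def)
  next
    fix D assume "D \<in> carrier ?D"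
    then have "(\<lambda>a\<in>carrier A. \<ominus>\<^bsub>A\<^esub> D a) \<in> carrier ?D \<and> (\<lambda>a\<in>carrier A. \<ominus>\<^bsub>A\<^esub> D a) \<oplus>\<^bsub>?D\<^esub> D = \<zero>\<^bsub>?D\<^esub>"
      apply (auto simp: Der_def linear_map_def PiE_iff Pi_iff A.M.minus_add A.smult_r_minus intro!: restrict_ext)
      subgoal by (simp add: A.M.minus_add A.l_minus A.r_minus)
      subgoal by (simp add: A.M.l_neg)
      done
    then show "\<exists>y\<in>carrier ?D. y \<oplus>\<^bsub>?D\<^esub> D = \<zero>\<^bsub>?D\<^esub>" by blast
  qed (auto simp: Der_def PiE_iff Pi_iff A.M.add.m_ac extensional_def fun_eq_iff)
  show ?thesis
  proof (rule moduleI)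
    show "cring A" by (rule A.M_cring)
  next
    fix b D assume b: "b \<in> carrier A" and D: "D \<in> carrier ?D"
    then have [simp]: "\<And>x. x \<in> carrier A \<Longrightarrow> D x \<in> carrier A" by (auto simp: Der_def)
    have "b \<otimes>\<^bsub>A\<^esub> (r \<odot>\<^bsub>A\<^esub> D x) = r \<odot>\<^bsub>A\<^esub> (b \<otimes>\<^bsub>A\<^esub> D x)" if "r \<in> carrier K" "x \<in> carrier A" for r x
      using b that by (metis \<open>\<And>x. x \<in> carrier A \<Longrightarrow> D x \<in> carrier A\<close> A.smult_assoc2 A.m_comm A.smult_closed)
    moreover have "b \<otimes>\<^bsub>A\<^esub> (D x \<otimes>\<^bsub>A\<^esub> y \<oplus>\<^bsub>A\<^esub> x \<otimes>\<^bsub>A\<^esub> D y) = b \<otimes>\<^bsub>A\<^esub> D x \<otimes>\<^bsub>A\<^esub> y \<oplus>\<^bsub>A\<^esub> x \<otimes>\<^bsub>A\<^esub> (b \<otimes>\<^bsub>A\<^esub> D y)"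
      if "x \<in> carrier A" "y \<in> carrier A" for x y
      using b that by (simp add: A.r_distr A.m_assoc A.m_lcomm)
    ultimately show "b \<odot>\<^bsub>?D\<^esub> D \<in> carrier ?D"
      using b D by (auto simp: Der_def linear_map_def A.r_distr)
  qed (rule ab, (auto simp: Der_def PiE_iff extensional_def fun_eq_iff Pi_iff A.l_distr A.r_distr A.m_assoc)[4])
qed


subsection \<open>\<open>n\<close>-Lie algebras and \<open>n\<close>-Lie--Rinehart algebras\<close>

locale n_lie_algebra = K?: field K + L?: module K L
  for K (structure) and L (structure) +
  fixes n :: nat and br :: "'l list \<Rightarrow> 'l"
  assumes n_ge_2: "n \<ge> 2"
    and bracket_alternating: "alternating_map K L L n br"
    and filippov: "\<lbrakk>xs \<in> tuples (n - 1) L; ys \<in> tuples n L\<rbrakk> \<Longrightarrow>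
      br (xs @ [br ys]) = (\<Oplus>\<^bsub>L\<^esub> i\<in>{..<n}. br (ys[i := br (xs @ [ys ! i])]))"

text \<open>
  The anchor is an alternating \<open>A\<close>-multilinear map \<open>L\<^sup>n\<^sup>-\<^sup>1 \<rightarrow> Der K A\<close>.  In \<open>anchor_circ\<close> the right-hand
  side is \<open>\<rho>(X \<circ> Y)\<close>: \<open>X \<circ> Y\<close> is the sum of the fundamental elements
  \<open>y\<^sub>1 \<and> \<dots> \<and> [X, y\<^sub>i] \<and> \<dots> \<and> y\<^sub>n\<^sub>-\<^sub>1\<close>, on which \<open>\<rho>\<close> is additive.
\<close>

locale n_lie_rinehart =
  K?: field K + A?: algebra K A + L?: module A L
  for K (structure) and A (structure) and L (structure) +
  fixes n :: nat and br :: "'l list \<Rightarrow> 'l" and \<rho> :: "'l list \<Rightarrow> 'a \<Rightarrow> 'a"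
  assumes char_zero: "char_zero K"
    and n_lie: "n_lie_algebra K (restrict_scalars A L) n br"
    and anchor_alternating: "alternating_map A L (Der K A) (n - 1) \<rho>"
    and anchor_circ: "\<lbrakk>xs \<in> tuples (n - 1) L; ys \<in> tuples (n - 1) L\<rbrakk> \<Longrightarrow>
      commutator A (\<rho> xs) (\<rho> ys) =
        (\<Oplus>\<^bsub>Der K A\<^esub> i\<in>{..<n - 1}. \<rho> (ys[i := br (xs @ [ys ! i])]))"
    and bracket_leibniz: "\<lbrakk>xs \<in> tuples (n - 1) L; a \<in> carrier A; y \<in> carrier L\<rbrakk> \<Longrightarrow>
      br (xs @ [a \<odot>\<^bsub>L\<^esub> y]) = a \<odot>\<^bsub>L\<^esub> br (xs @ [y]) \<oplus>\<^bsub>L\<^esub> \<rho> xs a \<odot>\<^bsub>L\<^esub> y"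


subsection \<open>Orthogonality defect\<close>

text \<open>\<open>orth_defect A br \<rho> B X u v\<close> is \<open>(D\<^sub>X B)(u, v)\<close>.\<close>

definition orth_defect ::
  "('a, 'd) ring_scheme \<Rightarrow> ('l list \<Rightarrow> 'l) \<Rightarrow> ('l list \<Rightarrow> 'a \<Rightarrow> 'a) \<Rightarrow> ('l \<Rightarrow> 'l \<Rightarrow> 'a) \<Rightarrow>
   'l list \<Rightarrow> 'l \<Rightarrow> 'l \<Rightarrow> 'a" where
  "orth_defect A br \<rho> B xs u v =
     \<rho> xs (B u v) \<ominus>\<^bsub>A\<^esub> B (br (xs @ [u])) v \<ominus>\<^bsub>A\<^esub> B u (br (xs @ [v]))"

text \<open>\<open>X\<^sub>a\<^sub>,\<^sub>i\<close> and \<open>X\<^sub>i(u)\<close>, with \<open>i\<close> counted from \<open>1\<close>.\<close>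

definition scale_at :: "('a, 'l, 'e) module_scheme \<Rightarrow> 'l list \<Rightarrow> 'a \<Rightarrow> nat \<Rightarrow> 'l list" where
  "scale_at L xs a i = xs[i - 1 := a \<odot>\<^bsub>L\<^esub> xs ! (i - 1)]"

definition omit_append :: "'l list \<Rightarrow> nat \<Rightarrow> 'l \<Rightarrow> 'l list" where
  "omit_append xs i u = take (i - 1) xs @ drop i xs @ [u]"

end

theory Submission
  imports Defs
begin

text \<open>
  The Leibniz rule only describes scalars in the last slot of the bracket.  Moving \<open>a x\<^sub>i\<close> there
  costs the sign \<open>(-1)\<^sup>n\<^sup>-\<^sup>i\<close>, and moving \<open>x\<^sub>i\<close> back afterwards costs it again, so
  \<open>[X\<^sub>a\<^sub>,\<^sub>i, u] = a [X, u] + (-1)\<^sup>n\<^sup>-\<^sup>i \<rho>(X\<^sub>i(u))(a) x\<^sub>i\<close>.  Since \<open>\<rho>(X\<^sub>a\<^sub>,\<^sub>i) = a \<rho>(X)\<close>, the claim follows by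
  bilinearity and symmetry of \<open>B\<close>.
\<close>

text \<open>The definition yields values in N only through linearity in a slot, so a slot must
  exist: for \<open>k = 0\<close> it says nothing about \<open>f []\<close>. Overwriting the first
  entry by itself brings \<open>f xs\<close> into that shape.\<close>

lemma alternating_map_closed:
  assumes "alternating_map R M N k f" and "xs \<in> tuples k M" and "0 < k"
  shows "f xs \<in> carrier N"
proof -
  have "linear_map R M N (\<lambda>z. f (xs[0 := z]))"
    using assms unfolding alternating_map_def by blast
  then have "(\<lambda>z. f (xs[0 := z])) \<in> carrier M \<rightarrow> carrier N"
    by (simp add: linear_map_def)
  moreover have "xs ! 0 \<in> carrier M"
    using assms(2,3) by (auto simp: tuples_def)
  ultimately have "f (xs[0 := xs ! 0]) \<in> carrier N"
    by (rule funcset_mem)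
  then show ?thesis by simp
qed

text \<open>Writing a slot as \<open>p @ x # q\<close> instead of by an index turns all later
  permutations of arguments into rearrangements of lists.\<close>

lemma alternating_map_linear_slot:
  assumes "alternating_map R M N k f" and "p @ x # q \<in> tuples k M"
  shows "linear_map R M N (\<lambda>z. f (p @ z # q))"
proof -
  have "length p < k"
    using assms(2) by (auto simp: tuples_def)
  with assms have "linear_map R M N (\<lambda>z. f ((p @ x # q)[length p := z]))"
    unfolding alternating_map_def by blast
  then show ?thesis by simp
qed

lemma alternating_map_equal_adjacent:
  assumes "alternating_map R M N k f" and "p @ x # x # q \<in> tuples k M"
  shows "f (p @ x # x # q) = \<zero>\<^bsub>N\<^esub>"
proof -
  have "length p < k" "Suc (length p) < k"
    using assms(2) by (auto simp: tuples_def)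
  moreover have "(p @ x # x # q) ! length p = (p @ x # x # q) ! Suc (length p)"
    by (simp add: nth_append)
  ultimately show ?thesis
    using assms unfolding alternating_map_def by (metis n_not_Suc_n)
qed

text \<open>Polarisation: expand the vanishing value with x + y in both adjacent slots. The two
  diagonal terms vanish as well, and the mixed terms must cancel.\<close>

lemma alternating_map_swap:
  assumes "abelian_group M" and "abelian_group N" and f: "alternating_map R M N k f"
    and t: "p @ x # y # q \<in> tuples k M"
  shows "f (p @ x # y # q) = \<ominus>\<^bsub>N\<^esub> f (p @ y # x # q)"
proof -
  interpret M: abelian_group M by fact
  interpret N: abelian_group N by fact
  have xy: "x \<in> carrier M" "y \<in> carrier M"
    using t by (auto simp: tuples_def)
  have tup: "p @ z # w # q \<in> tuples k M" if "z \<in> carrier M" "w \<in> carrier M" for z w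
    using t that by (auto simp: tuples_def)
  have cl: "f (p @ z # w # q) \<in> carrier N" if "z \<in> carrier M" "w \<in> carrier M" for z w
    using alternating_map_closed[OF f tup[OF that]] t by (auto simp: tuples_def)
  have add_l: "f (p @ (x \<oplus>\<^bsub>M\<^esub> y) # w # q) = f (p @ x # w # q) \<oplus>\<^bsub>N\<^esub> f (p @ y # w # q)"
    if "w \<in> carrier M" for w
    using alternating_map_linear_slot[OF f tup[OF xy(1) that]] xy by (simp add: linear_map_def)
  \<comment> \<open>Counting \<open>z\<close> as part of the prefix makes the second slot an
    instance of the same slot lemma.\<close>
  have add_r: "f (p @ z # (x \<oplus>\<^bsub>M\<^esub> y) # q) = f (p @ z # x # q) \<oplus>\<^bsub>N\<^esub> f (p @ z # y # q)"
    if "z \<in> carrier M" for z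
    using alternating_map_linear_slot[OF f, of "p @ [z]" x q] tup[OF that xy(1)] xy
    by (simp add: linear_map_def)
  have diag: "f (p @ z # z # q) = \<zero>\<^bsub>N\<^esub>" if "z \<in> carrier M" for z
    using alternating_map_equal_adjacent[OF f tup[OF that that]] .
  have "\<zero>\<^bsub>N\<^esub> = f (p @ (x \<oplus>\<^bsub>M\<^esub> y) # (x \<oplus>\<^bsub>M\<^esub> y) # q)"
    using diag xy by simp
  also have "\<dots> = f (p @ x # y # q) \<oplus>\<^bsub>N\<^esub> f (p @ y # x # q)"
    using xy cl by (simp add: add_l add_r N.a_comm diag[OF xy(1)] diag[OF xy(2)])
  finally show ?thesis
    using N.minus_equality cl xy by metis
qed

text \<open>One adjacent swap for each entry of \<open>ys\<close> that x passes. The sign is given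
  by parity because nothing is assumed about R that would make a power of -1 meaningful.\<close>

lemma alternating_map_move_last:
  assumes "abelian_group M" and "abelian_group N" and f: "alternating_map R M N k f"
    and "p @ x # ys \<in> tuples k M"
  shows "f (p @ x # ys) =
    (if even (length ys) then f (p @ ys @ [x]) else \<ominus>\<^bsub>N\<^esub> f (p @ ys @ [x]))"
  using assms(4)
proof (induction ys arbitrary: p)
  case Nil
  then show ?case by simp
next
  case (Cons y ys)
  interpret N: abelian_group N by fact
  \<comment> \<open>After the swap, y belongs to the prefix, so the induction hypothesis is needed
    for \<open>p @ [y]\<close>.\<close>
  have t: "(p @ [y]) @ x # ys \<in> tuples k M" and t': "p @ y # ys @ [x] \<in> tuples k M"
    using Cons.prems by (auto simp: tuples_def)
  have "f (p @ y # ys @ [x]) \<in> carrier N"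
    using alternating_map_closed[OF f t'] t' by (auto simp: tuples_def)
  moreover have "f (p @ x # y # ys) = \<ominus>\<^bsub>N\<^esub> f (p @ y # x # ys)"
    using alternating_map_swap[OF assms(1,2) f Cons.prems] .
  ultimately show ?case
    using Cons.IH[OF t] by simp
qed

lemma (in cring) minus_one_pow:
  "(\<ominus> \<one>) [^] (m::nat) = (if even m then \<one> else \<ominus> \<one>)"
  by (induction m) (auto simp: l_minus)

text \<open>The bracket is alternating only over K, but the sign rule rests on addition alone, which
  \<open>restrict_scalars\<close> leaves unchanged. Writing the sign as a scalar of A lets it be
  combined with a and with values of the anchor.\<close>

lemma (in n_lie_rinehart) bracket_move_last:
  assumes "p @ x # ys \<in> tuples n L"
  shows "br (p @ x # ys) = (\<ominus>\<^bsub>A\<^esub> \<one>\<^bsub>A\<^esub>) [^]\<^bsub>A\<^esub> length ys \<odot>\<^bsub>L\<^esub> br (p @ ys @ [x])"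
    and "br (p @ x # ys) \<in> carrier L"
proof -
  let ?L = "restrict_scalars A L"
  interpret nL: n_lie_algebra K ?L n br by (rule n_lie)
  have br: "alternating_map K ?L ?L n br" by (rule nL.bracket_alternating)
  have pos: "0 < n" using nL.n_ge_2 by simp
  have neg: "\<ominus>\<^bsub>?L\<^esub> z = \<ominus>\<^bsub>L\<^esub> z" for z
    by (simp add: restrict_scalars_def a_inv_def m_inv_def)
  have tup: "tuples n ?L = tuples n L"
    by (simp add: restrict_scalars_def tuples_def)
  have cl: "br zs \<in> carrier L" if "zs \<in> tuples n L" for zs
    using alternating_map_closed[OF br _ pos] that tup by (simp add: restrict_scalars_def)
  show "br (p @ x # ys) \<in> carrier L" using cl assms .
  have "p @ ys @ [x] \<in> tuples n L"
    using assms by (auto simp: tuples_def)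
  then have "br (p @ ys @ [x]) \<in> carrier L" by (rule cl)
  then have sign: "(\<ominus>\<^bsub>A\<^esub> \<one>\<^bsub>A\<^esub>) [^]\<^bsub>A\<^esub> length ys \<odot>\<^bsub>L\<^esub> br (p @ ys @ [x]) =
    (if even (length ys) then br (p @ ys @ [x]) else \<ominus>\<^bsub>L\<^esub> br (p @ ys @ [x]))"
    by (simp add: A.minus_one_pow L.smult_l_minus)
  show "br (p @ x # ys) = (\<ominus>\<^bsub>A\<^esub> \<one>\<^bsub>A\<^esub>) [^]\<^bsub>A\<^esub> length ys \<odot>\<^bsub>L\<^esub> br (p @ ys @ [x])"
    unfolding sign
    using alternating_map_move_last[OF nL.abelian_group_axioms nL.abelian_group_axioms br, of p x ys]
      assms tup neg by simp
qed

lemma (in n_lie_rinehart) anchor_in_Der: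
  assumes "xs \<in> tuples (n - 1) L"
  shows "\<rho> xs \<in> carrier (Der K A)"
proof -
  interpret nL: n_lie_algebra K "restrict_scalars A L" n br by (rule n_lie)
  show ?thesis
    using alternating_map_closed[OF anchor_alternating assms] nL.n_ge_2 by simp
qed

lemma (in n_lie_rinehart) anchor_closed:
  assumes "xs \<in> tuples (n - 1) L" and "b \<in> carrier A"
  shows "\<rho> xs b \<in> carrier A"
  using anchor_in_Der[OF assms(1)] assms(2) by (auto simp: Der_def)

lemma (in n_lie_rinehart) anchor_smult_slot:
  assumes "p @ x # q \<in> tuples (n - 1) L" and "a \<in> carrier A" and "b \<in> carrier A"
  shows "\<rho> (p @ (a \<odot>\<^bsub>L\<^esub> x) # q) b = a \<otimes>\<^bsub>A\<^esub> \<rho> (p @ x # q) b"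
proof -
  have "\<rho> (p @ (a \<odot>\<^bsub>L\<^esub> x) # q) = a \<odot>\<^bsub>Der K A\<^esub> \<rho> (p @ x # q)"
    using alternating_map_linear_slot[OF anchor_alternating assms(1)] assms(1,2)
    by (simp add: linear_map_def tuples_def)
  then show ?thesis using assms(3) by (simp add: Der_def)
qed

lemma (in n_lie_rinehart) bracket_smult_slot:
  assumes t: "p @ x # q \<in> tuples (n - 1) L"
    and a: "a \<in> carrier A" and u: "u \<in> carrier L"
  shows "br (p @ (a \<odot>\<^bsub>L\<^esub> x) # q @ [u]) =
    a \<odot>\<^bsub>L\<^esub> br (p @ x # q @ [u]) \<oplus>\<^bsub>L\<^esub>
    ((\<ominus>\<^bsub>A\<^esub> \<one>\<^bsub>A\<^esub>) [^]\<^bsub>A\<^esub> Suc (length q) \<otimes>\<^bsub>A\<^esub> \<rho> (p @ q @ [u]) a) \<odot>\<^bsub>L\<^esub> x"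
proof -
  \<comment> \<open>The successor accounts for u: the entry moved to the end passes all of
    \<open>q\<close> and then u.\<close>
  define s where "s = (\<ominus>\<^bsub>A\<^esub> \<one>\<^bsub>A\<^esub>) [^]\<^bsub>A\<^esub> Suc (length q)"
  have s: "s \<in> carrier A" unfolding s_def by simp
  have x: "x \<in> carrier L" using t by (auto simp: tuples_def)
  have tn: "p @ z # q @ [u] \<in> tuples n L" and tn': "p @ q @ [u, z] \<in> tuples n L"
    if "z \<in> carrier L" for z
    using t u that by (auto simp: tuples_def)
  have tr: "p @ q @ [u] \<in> tuples (n - 1) L"
    using t u by (auto simp: tuples_def)
  have move: "br (p @ z # q @ [u]) = s \<odot>\<^bsub>L\<^esub> br (p @ q @ [u, z])" if "z \<in> carrier L" for z
    using bracket_move_last(1)[OF tn[OF that]] by (simp add: s_def)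
  have cl: "br (p @ q @ [u, x]) \<in> carrier L"
    using bracket_move_last(2)[of "p @ q @ [u]" x "[]"] tn'[OF x] by simp
  have r: "\<rho> (p @ q @ [u]) a \<in> carrier A"
    using anchor_closed[OF tr a] .
  have "br (p @ (a \<odot>\<^bsub>L\<^esub> x) # q @ [u]) = s \<odot>\<^bsub>L\<^esub> br (p @ q @ [u, a \<odot>\<^bsub>L\<^esub> x])"
    using a x by (simp add: move)
  also have "\<dots> = s \<odot>\<^bsub>L\<^esub> (a \<odot>\<^bsub>L\<^esub> br (p @ q @ [u, x]) \<oplus>\<^bsub>L\<^esub> \<rho> (p @ q @ [u]) a \<odot>\<^bsub>L\<^esub> x)"
    using bracket_leibniz[OF tr a x] by simp
  also have "\<dots> = a \<odot>\<^bsub>L\<^esub> (s \<odot>\<^bsub>L\<^esub> br (p @ q @ [u, x])) \<oplus>\<^bsub>L\<^esub> (s \<otimes>\<^bsub>A\<^esub> \<rho> (p @ q @ [u]) a) \<odot>\<^bsub>L\<^esub> x"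
    using s a x r cl by (simp add: L.smult_r_distr A.m_comm flip: L.smult_assoc1)
  \<comment> \<open>By \<open>move\<close> at z = x, the sign in the first summand is the one
    relating the two positions of x. It is absorbed there and survives only on the anchor
    term.\<close>
  finally show ?thesis
    using x by (simp add: move s_def)
qed

theorem theorem4p8:
  fixes K :: "('k, 'c) ring_scheme" and A :: "('k, 'a, 'd) module_scheme"
    and L :: "('a, 'l, 'e) module_scheme"
    and n i :: nat and br :: "'l list \<Rightarrow> 'l" and \<rho> :: "'l list \<Rightarrow> 'a \<Rightarrow> 'a"
    and B :: "'l \<Rightarrow> 'l \<Rightarrow> 'a"
  assumes "n_lie_rinehart K A L n br \<rho>"
    and "symmetric_bilinear_form A L B"
    and "xs \<in> tuples (n - 1) L"
    and "1 \<le> i" and "i \<le> n - 1"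
    and "a \<in> carrier A" and "u \<in> carrier L" and "v \<in> carrier L"
  shows "orth_defect A br \<rho> B (scale_at L xs a i) u v =
      a \<otimes>\<^bsub>A\<^esub> orth_defect A br \<rho> B xs u v
      \<ominus>\<^bsub>A\<^esub> (\<ominus>\<^bsub>A\<^esub> \<one>\<^bsub>A\<^esub>) [^]\<^bsub>A\<^esub> (n - i) \<otimes>\<^bsub>A\<^esub> \<rho> (omit_append xs i u) a \<otimes>\<^bsub>A\<^esub> B (xs ! (i - 1)) v
      \<ominus>\<^bsub>A\<^esub> (\<ominus>\<^bsub>A\<^esub> \<one>\<^bsub>A\<^esub>) [^]\<^bsub>A\<^esub> (n - i) \<otimes>\<^bsub>A\<^esub> \<rho> (omit_append xs i v) a \<otimes>\<^bsub>A\<^esub> B (xs ! (i - 1)) u"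
proof -
  interpret n_lie_rinehart K A L n br \<rho> by fact
  \<comment> \<open>Position i counted from 1 is list index i - 1, so \<open>drop i\<close> starts
    just after x.\<close>
  define p q x where "p = take (i - 1) xs" and "q = drop i xs" and "x = xs ! (i - 1)"
  note a = \<open>a \<in> carrier A\<close> and u = \<open>u \<in> carrier L\<close> and v = \<open>v \<in> carrier L\<close>
  have len: "length xs = n - 1" using assms(3) by (simp add: tuples_def)
  have i: "i - 1 < length xs" using assms(4,5) len by simp
  have xs: "xs = p @ x # q"
    using id_take_nth_drop[OF i] assms(4) by (simp add: p_def q_def x_def)
  have lp: "length p = i - 1" using i by (simp add: p_def)
  \<comment> \<open>There are n - 1 - i entries behind x, and the appended u or v is one more; this
    is the exponent n - i of the claim.\<close>
  have lq: "Suc (length q) = n - i" using assms(4,5) len by (simp add: q_def)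
  have t: "p @ x # q \<in> tuples (n - 1) L" using assms(3) xs by simp
  have x: "x \<in> carrier L" using t by (auto simp: tuples_def)
  have scale: "scale_at L xs a i = p @ (a \<odot>\<^bsub>L\<^esub> x) # q"
    unfolding scale_at_def x_def[symmetric] lp[symmetric] by (simp add: xs)
  have omit: "omit_append xs i w = p @ q @ [w]" for w
    by (simp add: omit_append_def p_def q_def)
  define s where "s = (\<ominus>\<^bsub>A\<^esub> \<one>\<^bsub>A\<^esub>) [^]\<^bsub>A\<^esub> (n - i)"
  have s: "s \<in> carrier A" unfolding s_def by simp
  have brw: "br (p @ x # q @ [w]) \<in> carrier L" if "w \<in> carrier L" for w
    using t that by (intro bracket_move_last(2)) (auto simp: tuples_def)
  have r: "\<rho> (p @ q @ [w]) a \<in> carrier A" if "w \<in> carrier L" for w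
    using t that a by (intro anchor_closed) (auto simp: tuples_def)
  have B_cl: "B y z \<in> carrier A" if "y \<in> carrier L" "z \<in> carrier L" for y z
    using assms(2) that by (auto simp: symmetric_bilinear_form_def linear_map_def regular_module_def)
  have B_sym: "B y z = B z y" if "y \<in> carrier L" "z \<in> carrier L" for y z
    using assms(2) that by (auto simp: symmetric_bilinear_form_def)
  have B_comb: "B (b \<odot>\<^bsub>L\<^esub> y \<oplus>\<^bsub>L\<^esub> c \<odot>\<^bsub>L\<^esub> w) z = b \<otimes>\<^bsub>A\<^esub> B y z \<oplus>\<^bsub>A\<^esub> c \<otimes>\<^bsub>A\<^esub> B w z"
    if "y \<in> carrier L" "z \<in> carrier L" "w \<in> carrier L" "b \<in> carrier A" "c \<in> carrier A" for b c y z w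
    using assms(2) that by (simp add: symmetric_bilinear_form_def linear_map_def regular_module_def)
  \<comment> \<open>Stated for arbitrary w and z so that it serves both bracket terms of the defect:
    (u, v) directly, and (v, u) after symmetry of B.\<close>
  have B_br: "B (br (p @ (a \<odot>\<^bsub>L\<^esub> x) # q @ [w])) z =
      a \<otimes>\<^bsub>A\<^esub> B (br (p @ x # q @ [w])) z \<oplus>\<^bsub>A\<^esub> s \<otimes>\<^bsub>A\<^esub> \<rho> (p @ q @ [w]) a \<otimes>\<^bsub>A\<^esub> B x z"
    if "w \<in> carrier L" "z \<in> carrier L" for w z
    unfolding bracket_smult_slot[OF t a that(1)] lq s_def[symmetric]
    using that a s x brw r by (simp add: B_comb)
  have "p @ (a \<odot>\<^bsub>L\<^esub> x) # q \<in> tuples (n - 1) L"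
    using t a by (auto simp: tuples_def)
  \<comment> \<open>This closure licenses exchanging the arguments of B in the last term of the
    defect.\<close>
  then have brw': "br (p @ (a \<odot>\<^bsub>L\<^esub> x) # q @ [v]) \<in> carrier L"
    using v by (intro bracket_move_last(2)) (auto simp: tuples_def)
  define R where "R = \<rho> (p @ x # q) (B u v)"
  have R: "R \<in> carrier A" unfolding R_def using anchor_closed[OF t] B_cl u v by simp
  \<comment> \<open>In \<open>b\<^sub>v\<close> the bracket stands first, with u second, so that
    scaling produces B(x, u) as in the claim.\<close>
  define b\<^sub>u b\<^sub>v where "b\<^sub>u = B (br (p @ x # q @ [u])) v" and "b\<^sub>v = B (br (p @ x # q @ [v])) u"
  define c\<^sub>u c\<^sub>v where "c\<^sub>u = s \<otimes>\<^bsub>A\<^esub> \<rho> (p @ q @ [u]) a \<otimes>\<^bsub>A\<^esub> B x v"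
    and "c\<^sub>v = s \<otimes>\<^bsub>A\<^esub> \<rho> (p @ q @ [v]) a \<otimes>\<^bsub>A\<^esub> B x u"
  have cl: "b\<^sub>u \<in> carrier A" "b\<^sub>v \<in> carrier A" "c\<^sub>u \<in> carrier A" "c\<^sub>v \<in> carrier A"
    unfolding b\<^sub>u_def b\<^sub>v_def c\<^sub>u_def c\<^sub>v_def using s r brw B_cl x u v by simp_all
  have "orth_defect A br \<rho> B (scale_at L xs a i) u v =
      a \<otimes>\<^bsub>A\<^esub> R \<ominus>\<^bsub>A\<^esub> (a \<otimes>\<^bsub>A\<^esub> b\<^sub>u \<oplus>\<^bsub>A\<^esub> c\<^sub>u) \<ominus>\<^bsub>A\<^esub> (a \<otimes>\<^bsub>A\<^esub> b\<^sub>v \<oplus>\<^bsub>A\<^esub> c\<^sub>v)"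
    unfolding orth_defect_def scale R_def b\<^sub>u_def b\<^sub>v_def c\<^sub>u_def c\<^sub>v_def
    using anchor_smult_slot[OF t a] B_cl B_br[OF u v] B_br[OF v u] B_sym[OF u brw'] u v by simp
  \<comment> \<open>With the five quantities opaque, this is an identity of the commutative ring A:
    a factors out of the defect of X and the two anchor terms remain.\<close>
  also have "\<dots> = a \<otimes>\<^bsub>A\<^esub> (R \<ominus>\<^bsub>A\<^esub> b\<^sub>u \<ominus>\<^bsub>A\<^esub> b\<^sub>v) \<ominus>\<^bsub>A\<^esub> c\<^sub>u \<ominus>\<^bsub>A\<^esub> c\<^sub>v"
    using a R cl
    by (simp add: a_minus_def A.M.minus_add A.r_distr A.r_minus A.M.add.m_ac)
  also have "R \<ominus>\<^bsub>A\<^esub> b\<^sub>u \<ominus>\<^bsub>A\<^esub> b\<^sub>v = orth_defect A br \<rho> B xs u v"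
    unfolding orth_defect_def R_def b\<^sub>u_def b\<^sub>v_def using B_sym[OF u brw[OF v]] by (simp add: xs)
  finally show ?thesis
    by (simp add: c\<^sub>u_def c\<^sub>v_def omit s_def x_def)
qed

end
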